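(* Let $G_1$ and $G_2$ be finite simple connected graphs, each with at least three vertices, with $V(G_1)\cap V(G_2)=\{v\}$, and let $G=G_1\cup G_2$. Suppose one of the following conditions holds: (i) $\deg_G(v)\geq 4$, $\mu(G_i)\leq 2$ for $i=1,2$, and $\deg_G(u)\leq 2$ for every $u\in N_G(v)$; (ii) $\deg_G(v)\geq 4$, $\mu(G_1)\leq 2$, $\deg_G(u)\leq 2$ for every $u\in N_G(v)$, and $G_2$ is a cycle; (iii) $G_1$ and $G_2$ are cycles. Then $\mu(G)\leq 2$.
   Context: A $k$-edge-weighting of a graph $G$ is a function $w:E(G)\to\{1,2,\ldots,k\}$. It induces a vertex coloring $c$ by $c(v)=\sum_{e\sim v}w(e)$, where $e\sim v$ means that $e$ is an edge incident to $v$. If $c$ is a proper vertex coloring ($c(u)\neq c(v)$ for every two adjacent vertices $u,v$), then $w$ is called a vertex-coloring $k$-edge-weighting (VC$k$-EW). $\mu(G)$ denotes the minimum $k$ for which $G$ has a VC$k$-EW. $N_G(v)$ is the set of neighbours of $v$ in $G$, and $G_1\cup G_2$ is the graph with vertex set $V(G_1)\cup V(G_2)$ and edge set $E(G_1)\cup E(G_2)$. *)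

theory Defs
  imports Main "HOL-Library.FuncSet" "HOL-Library.Extended_Nat"
begin

record 'a graph =
  verts :: "'a set"
  edges :: "'a set set"

definition finite_simple_graph :: "'a graph \<Rightarrow> bool" where
  "finite_simple_graph G \<longleftrightarrow>
     finite (verts G) \<and> (\<forall>e\<in>edges G. e \<subseteq> verts G \<and> card e = 2)"

definition neighbours :: "'a graph \<Rightarrow> 'a \<Rightarrow> 'a set" where
  "neighbours G v = {u. {u, v} \<in> edges G}"

definition degree :: "'a graph \<Rightarrow> 'a \<Rightarrow> nat" where
  "degree G v = card {e \<in> edges G. v \<in> e}"

definition connected_graph :: "'a graph \<Rightarrow> bool" where
  "connected_graph G \<longleftrightarrow> verts G \<noteq> {} \<and>
     (\<forall>u\<in>verts G. \<forall>v\<in>verts G. (u, v) \<in> {(x, y). {x, y} \<in> edges G}\<^sup>*)"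

definition graph_union :: "'a graph \<Rightarrow> 'a graph \<Rightarrow> 'a graph" where
  "graph_union G\<^sub>1 G\<^sub>2 =
     \<lparr>verts = verts G\<^sub>1 \<union> verts G\<^sub>2, edges = edges G\<^sub>1 \<union> edges G\<^sub>2\<rparr>"

definition is_cycle :: "'a graph \<Rightarrow> bool" where
  "is_cycle G \<longleftrightarrow> (\<exists>n\<ge>3. \<exists>f :: nat \<Rightarrow> 'a. bij_betw f {..<n} (verts G) \<and>
     edges G = {{f i, f ((i + 1) mod n)} | i. i < n})"

text \<open>Only the values of a weighting on \<open>edges G\<close> matter; elsewhere it is arbitrary.\<close>

definition edge_weighting :: "'a graph \<Rightarrow> nat \<Rightarrow> ('a set \<Rightarrow> nat) \<Rightarrow> bool" where
  "edge_weighting G k w \<longleftrightarrow> w \<in> edges G \<rightarrow> {1..k}"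

definition induced_coloring :: "'a graph \<Rightarrow> ('a set \<Rightarrow> nat) \<Rightarrow> 'a \<Rightarrow> nat" where
  "induced_coloring G w v = (\<Sum>e\<in>{e \<in> edges G. v \<in> e}. w e)"

definition proper_coloring :: "'a graph \<Rightarrow> ('a \<Rightarrow> 'b) \<Rightarrow> bool" where
  "proper_coloring G c \<longleftrightarrow> (\<forall>u v. {u, v} \<in> edges G \<longrightarrow> c u \<noteq> c v)"

definition vertex_coloring_edge_weighting :: "'a graph \<Rightarrow> nat \<Rightarrow> ('a set \<Rightarrow> nat) \<Rightarrow> bool" where
  "vertex_coloring_edge_weighting G k w \<longleftrightarrow>
     edge_weighting G k w \<and> proper_coloring G (induced_coloring G w)"

text \<open>
  The infimum over \<^typ>\<open>enat\<close> is a minimum whenever some \<open>k\<close> admits such a weighting, and is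
  \<open>\<infinity>\<close> otherwise (as for a single edge), so that \<open>mu G \<le> k\<close> never holds vacuously.
\<close>

definition mu :: "'a graph \<Rightarrow> enat" where
  "mu G = (INF k \<in> {k. \<exists>w. vertex_coloring_edge_weighting G k w}. enat k)"

end

theory Submission
  imports Defs
begin

text \<open>
  The vertex \<open>v\<close> takes care of itself. If \<open>v\<close> has degree at least 4 and a neighbour \<open>u\<close> has degree
  at most 2, then under every weighting by 1 and 2 the edge \<open>uv\<close> contributes equally to both colours,
  while the other edges add at least 3 at \<open>v\<close> and at most 2 at \<open>u\<close>; hence \<open>c(v) > c(u)\<close>
  (\<open>vertex_coloring_if_proper_off_high_degree_vertex\<close>). It therefore suffices to weight \<open>G\<close> so that
  the edges avoiding \<open>v\<close> are properly coloured. Such an edge lies in one of the two parts, and its ends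
  have the same incident edges in \<open>G\<close> as in that part, so suitable weightings of the parts can be
  chosen independently and glued together (\<open>proper_off_union\<close>).

  A part with \<open>mu \<le> 2\<close> has such a weighting by definition. A cycle always has one, even if its own
  \<open>mu\<close> is 3: going around from \<open>v\<close>, use the weights 1, 1, 2, 2, 1, 1, 2, 2, \<open>\<dots>\<close>
  (\<open>cycle_proper_off\<close>). The ends of an edge get different colours exactly if the preceding and the
  following edge have different weights, and this can fail only at the two edges where the pattern
  closes up, which are the edges at \<open>v\<close>. Finally, the degree conditions hold automatically if both
  parts are cycles.
\<close>

section \<open>Weightings that are proper away from one vertex\<close>

definition proper_off :: "'a graph \<Rightarrow> 'a \<Rightarrow> ('a set \<Rightarrow> nat) \<Rightarrow> bool" where
  "proper_off G v w \<longleftrightarrow> edge_weighting G 2 w \<and>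
     (\<forall>x y. {x, y} \<in> edges G \<longrightarrow> x \<noteq> v \<longrightarrow> y \<noteq> v \<longrightarrow>
        induced_coloring G w x \<noteq> induced_coloring G w y)"

lemma proper_offD:
  assumes "proper_off G v w"
  shows "edge_weighting G 2 w"
    and "{x, y} \<in> edges G \<Longrightarrow> x \<noteq> v \<Longrightarrow> y \<noteq> v \<Longrightarrow>
      induced_coloring G w x \<noteq> induced_coloring G w y"
  using assms unfolding proper_off_def by simp_all

lemma edge_ends:
  assumes "finite_simple_graph G" "{x, y} \<in> edges G"
  shows "x \<in> verts G" "y \<in> verts G" "x \<noteq> y"
  using assms unfolding finite_simple_graph_def by fastforce+

text \<open>
  Every nonempty set of extended naturals contains its infimum, so \<open>mu G\<close> is attained if it is finite;
  and a weighting by \<open>{1..j}\<close> is also one by \<open>{1..k}\<close> for every \<open>k \<ge> j\<close>.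
\<close>

lemma mu_le_iff:
  "mu G \<le> enat k \<longleftrightarrow> (\<exists>w. vertex_coloring_edge_weighting G k w)"
proof
  let ?S = "{k. \<exists>w. vertex_coloring_edge_weighting G k w}"
  assume le: "mu G \<le> enat k"
  have "?S \<noteq> {}"
  proof
    assume "?S = {}"
    then have "mu G = \<infinity>" unfolding mu_def \<open>?S = {}\<close> by (simp add: top_enat_def)
    with le show False by simp
  qed
  then obtain i where "i \<in> ?S" by blast
  then have "(INF k \<in> ?S. enat k) \<in> enat ` ?S"
    by (intro wellorder_InfI[of "enat i"] imageI)
  then obtain j w where j: "mu G = enat j" "vertex_coloring_edge_weighting G j w"
    unfolding mu_def by auto
  with le have "{1..j} \<subseteq> {1..k}" by simp
  with j(2) have "vertex_coloring_edge_weighting G k w"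
    unfolding vertex_coloring_edge_weighting_def edge_weighting_def by blast
  then show "\<exists>w. vertex_coloring_edge_weighting G k w" by blast
next
  assume "\<exists>w. vertex_coloring_edge_weighting G k w"
  then show "mu G \<le> enat k" unfolding mu_def by (intro INF_lower) simp
qed

lemma mu_le_2_proper_off:
  assumes "mu G \<le> 2"
  shows "\<exists>w. proper_off G v w"
  using assms mu_le_iff[of G 2]
  unfolding numeral_eq_enat proper_off_def vertex_coloring_edge_weighting_def proper_coloring_def
  by blast

lemma finite_edges: "finite_simple_graph G \<Longrightarrow> finite (edges G)"
  unfolding finite_simple_graph_def by (meson Pow_iff finite_Pow_iff finite_subset subsetI)

lemma incident_weight_split:
  assumes "finite (edges G)" "e \<in> edges G" "x \<in> e"
  shows "induced_coloring G w x = w e + sum w ({e \<in> edges G. x \<in> e} - {e})"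
    and "degree G x = Suc (card ({e \<in> edges G. x \<in> e} - {e}))"
proof -
  have "finite {e \<in> edges G. x \<in> e}" "e \<in> {e \<in> edges G. x \<in> e}"
    using assms by simp_all
  then show "induced_coloring G w x = w e + sum w ({e \<in> edges G. x \<in> e} - {e})"
    and "degree G x = Suc (card ({e \<in> edges G. x \<in> e} - {e}))"
    unfolding induced_coloring_def degree_def by (rule sum.remove, rule card.remove)
qed

text \<open>
  The common edge contributes equally to the colours of its ends. At \<open>v\<close> there are at least three
  further edges of weight at least 1, at the neighbour at most one further edge of weight at most 2.
\<close>

lemma vertex_coloring_if_proper_off_high_degree_vertex:
  assumes fin: "finite (edges G)" and off: "proper_off G v w"
    and deg_v: "degree G v \<ge> 4" and deg_nb: "\<forall>u\<in>neighbours G v. degree G u \<le> 2"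
  shows "vertex_coloring_edge_weighting G 2 w"
proof -
  have bounds: "1 \<le> w e" "w e \<le> 2" if "e \<in> edges G" for e
    using proper_offD(1)[OF off] that unfolding edge_weighting_def by force+
  have less: "induced_coloring G w u < induced_coloring G w v" if e: "{u, v} \<in> edges G" for u
  proof -
    let ?R = "\<lambda>x. {e \<in> edges G. x \<in> e} - {{u, v}}"
    have "degree G u \<le> 2" using deg_nb e by (simp add: neighbours_def)
    then have "card (?R u) \<le> 1" "3 \<le> card (?R v)"
      using incident_weight_split(2)[OF fin e, of u] incident_weight_split(2)[OF fin e, of v] deg_v
      by auto
    moreover have "sum w (?R u) \<le> card (?R u) * 2"
      using sum_bounded_above[of "?R u" w 2] bounds by simp
    moreover have "card (?R v) * 1 \<le> sum w (?R v)"
      using sum_bounded_below[of "?R v" 1 w] bounds by simp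
    ultimately show ?thesis
      using incident_weight_split(1)[OF fin e, of u w] incident_weight_split(1)[OF fin e, of v w]
      by auto
  qed
  have "induced_coloring G w x \<noteq> induced_coloring G w y" if e: "{x, y} \<in> edges G" for x y
  proof -
    consider "x = v" | "y = v" | "x \<noteq> v" "y \<noteq> v" by blast
    then show ?thesis
    proof cases
      case 1
      then show ?thesis using less[of y] e by (simp add: insert_commute)
    next
      case 2
      then show ?thesis using less[of x] e by simp
    next
      case 3
      then show ?thesis using proper_offD(2)[OF off e] by simp
    qed
  qed
  then show ?thesis
    using proper_offD(1)[OF off]
    unfolding vertex_coloring_edge_weighting_def proper_coloring_def by simp
qed

section \<open>Two graphs sharing one vertex\<close>

lemma graph_union_commute: "graph_union G\<^sub>1 G\<^sub>2 = graph_union G\<^sub>2 G\<^sub>1"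
  by (simp add: graph_union_def Un_commute)

lemma edges_disjoint_if_one_common_vertex:
  assumes "finite_simple_graph G\<^sub>1" "finite_simple_graph G\<^sub>2" "verts G\<^sub>1 \<inter> verts G\<^sub>2 = {v}"
  shows "edges G\<^sub>1 \<inter> edges G\<^sub>2 = {}"
proof (rule ccontr)
  assume "edges G\<^sub>1 \<inter> edges G\<^sub>2 \<noteq> {}"
  then obtain e where "e \<in> edges G\<^sub>1" "e \<in> edges G\<^sub>2" by blast
  then have "card e = 2" "e \<subseteq> {v}"
    using assms unfolding finite_simple_graph_def by blast+
  then show False using card_mono[of "{v}" e] by simp
qed

lemma incident_edges_union:
  assumes "finite_simple_graph G\<^sub>2" "verts G\<^sub>1 \<inter> verts G\<^sub>2 = {v}" "x \<in> verts G\<^sub>1" "x \<noteq> v"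
  shows "{e \<in> edges (graph_union G\<^sub>1 G\<^sub>2). x \<in> e} = {e \<in> edges G\<^sub>1. x \<in> e}"
  using assms unfolding graph_union_def finite_simple_graph_def by auto

lemma degree_union_common_vertex:
  assumes "finite_simple_graph G\<^sub>1" "finite_simple_graph G\<^sub>2" "verts G\<^sub>1 \<inter> verts G\<^sub>2 = {v}"
  shows "degree (graph_union G\<^sub>1 G\<^sub>2) v = degree G\<^sub>1 v + degree G\<^sub>2 v"
proof -
  have "{e \<in> edges (graph_union G\<^sub>1 G\<^sub>2). v \<in> e} = {e \<in> edges G\<^sub>1. v \<in> e} \<union> {e \<in> edges G\<^sub>2. v \<in> e}"
    by (auto simp: graph_union_def)
  moreover have "card ({e \<in> edges G\<^sub>1. v \<in> e} \<union> {e \<in> edges G\<^sub>2. v \<in> e})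
    = card {e \<in> edges G\<^sub>1. v \<in> e} + card {e \<in> edges G\<^sub>2. v \<in> e}"
    using edges_disjoint_if_one_common_vertex[OF assms] finite_edges[OF assms(1)]
      finite_edges[OF assms(2)]
    by (intro card_Un_disjoint) auto
  ultimately show ?thesis unfolding degree_def by simp
qed

text \<open>
  A vertex other than \<open>v\<close> meets edges of one part only, so its colour in the union is its colour in
  that part. The colour of \<open>v\<close> does mix the two weightings, but no edge at \<open>v\<close> is constrained here.
\<close>

lemma proper_off_union:
  assumes fsg: "finite_simple_graph G\<^sub>1" "finite_simple_graph G\<^sub>2"
    and common: "verts G\<^sub>1 \<inter> verts G\<^sub>2 = {v}"
    and off: "proper_off G\<^sub>1 v w\<^sub>1" "proper_off G\<^sub>2 v w\<^sub>2"
  shows "proper_off (graph_union G\<^sub>1 G\<^sub>2) v (\<lambda>e. if e \<in> edges G\<^sub>1 then w\<^sub>1 e else w\<^sub>2 e)"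
    (is "proper_off ?G v ?w")
proof -
  have disj: "edges G\<^sub>1 \<inter> edges G\<^sub>2 = {}"
    using edges_disjoint_if_one_common_vertex[OF fsg common] .
  have col1: "induced_coloring ?G ?w x = induced_coloring G\<^sub>1 w\<^sub>1 x"
    if "x \<in> verts G\<^sub>1" "x \<noteq> v" for x
    using incident_edges_union[OF fsg(2) common that]
    unfolding induced_coloring_def by (auto intro: sum.cong)
  have col2: "induced_coloring ?G ?w x = induced_coloring G\<^sub>2 w\<^sub>2 x"
    if "x \<in> verts G\<^sub>2" "x \<noteq> v" for x
  proof -
    have "verts G\<^sub>2 \<inter> verts G\<^sub>1 = {v}" using common by (simp add: Int_commute)
    from incident_edges_union[OF fsg(1) this that]
    have "{e \<in> edges ?G. x \<in> e} = {e \<in> edges G\<^sub>2. x \<in> e}"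
      by (subst graph_union_commute)
    moreover have "e \<notin> edges G\<^sub>1" if "e \<in> edges G\<^sub>2" for e
      using disj that by blast
    ultimately show ?thesis
      unfolding induced_coloring_def by (auto intro: sum.cong)
  qed
  have "induced_coloring ?G ?w x \<noteq> induced_coloring ?G ?w y"
    if e: "{x, y} \<in> edges ?G" and ne: "x \<noteq> v" "y \<noteq> v" for x y
  proof -
    consider "{x, y} \<in> edges G\<^sub>1" | "{x, y} \<in> edges G\<^sub>2"
      using e by (auto simp: graph_union_def)
    then show ?thesis
    proof cases
      case 1
      then show ?thesis
        using edge_ends[OF fsg(1) 1] proper_offD(2)[OF off(1) 1 ne] col1 ne by simp
    next
      case 2
      then show ?thesis
        using edge_ends[OF fsg(2) 2] proper_offD(2)[OF off(2) 2 ne] col2 ne by simp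
    qed
  qed
  moreover have "edge_weighting ?G 2 ?w"
  proof -
    have "edge_weighting G\<^sub>1 2 w\<^sub>1" "edge_weighting G\<^sub>2 2 w\<^sub>2"
      using off by (simp_all add: proper_offD(1))
    then show ?thesis unfolding edge_weighting_def graph_union_def by (auto simp: Pi_iff)
  qed
  ultimately show ?thesis unfolding proper_off_def by blast
qed

section \<open>Cycles\<close>

text \<open>The numbering of a cycle can be rotated, here by the number \<open>j\<close> of \<open>v\<close>.\<close>

lemma cycle_starting_at:
  fixes G :: "'a graph"
  assumes "is_cycle G" "v \<in> verts G"
  obtains n :: nat and f :: "nat \<Rightarrow> 'a" where "n \<ge> 3" "bij_betw f {..<n} (verts G)"
    "edges G = (\<lambda>i. {f i, f ((i + 1) mod n)}) ` {..<n}" "f 0 = v"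
proof -
  obtain n :: nat and f :: "nat \<Rightarrow> 'a"
    where n: "n \<ge> 3" and bij: "bij_betw f {..<n} (verts G)"
    and E: "edges G = {{f i, f ((i + 1) mod n)} | i. i < n}"
    using assms(1) unfolding is_cycle_def by blast
  obtain j where j: "j < n" "f j = v"
    using assms(2) unfolding bij_betw_imp_surj_on[OF bij, symmetric] by auto
  define r where "r i = (i + j) mod n" for i
  have r_eq: "r a = (if a + j < n then a + j else a + j - n)" if "a < n" for a
    using that j(1) unfolding r_def by (simp add: mod_if[of "a + j"])
  have "inj_on r {..<n}"
  proof (rule inj_onI)
    fix a b assume "a \<in> {..<n}" "b \<in> {..<n}" "r a = r b"
    then show "a = b" using j(1) by (auto simp: r_eq split: if_splits)
  qed
  moreover have "r ` {..<n} \<subseteq> {..<n}" using n by (auto simp: r_def)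
  ultimately have r: "bij_betw r {..<n} {..<n}"
    unfolding bij_betw_def by (simp add: endo_inj_surj)
  have r_next: "r ((i + 1) mod n) = (r i + 1) mod n" for i
    unfolding r_def by (simp add: mod_simps)
  have "{{f i, f ((i + 1) mod n)} | i. i < n} = (\<lambda>i. {f i, f ((i + 1) mod n)}) ` r ` {..<n}"
    using r unfolding bij_betw_def by auto
  also have "\<dots> = (\<lambda>i. {(f \<circ> r) i, (f \<circ> r) ((i + 1) mod n)}) ` {..<n}"
    unfolding image_image o_def r_next ..
  finally show thesis
    using that[OF n bij_betw_trans[OF r bij]] E j by (simp add: r_eq)
qed

text \<open>
  Numbering the edges lets a weighting of the cycle be given by a sequence. This would break down for
  two vertices, where the edges 0 and 1 coincide.
\<close>

lemma cycle_incident_edges: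
  fixes f :: "nat \<Rightarrow> 'a"
  defines "E \<equiv> \<lambda>n i. {f i, f ((i + 1) mod n)}"
  assumes n: "n \<ge> 3" and inj: "inj_on f {..<n}"
  shows "inj_on (E n) {..<n}"
    and "i < n \<Longrightarrow> {e \<in> E n ` {..<n}. f i \<in> e} = {E n i, E n (if i = 0 then n - 1 else i - 1)}"
proof -
  have next_index: "Suc i mod n = (if Suc i = n then 0 else Suc i)" if "i < n" for i
    using that by auto
  have f_eq: "f a = f b \<longleftrightarrow> a = b" if "a < n" "b < n" for a b
    using inj that by (auto simp: inj_on_def)
  show "inj_on (E n) {..<n}"
  proof (rule inj_onI)
    fix a b assume "a \<in> {..<n}" "b \<in> {..<n}" "E n a = E n b"
    then show "a = b"
      using n unfolding E_def doubleton_eq_iff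
      by (auto simp: f_eq next_index split: if_splits)
  qed
  show "{e \<in> E n ` {..<n}. f i \<in> e} = {E n i, E n (if i = 0 then n - 1 else i - 1)}"
    if i: "i < n"
  proof -
    have "f i \<in> E n k \<longleftrightarrow> k = i \<or> k = (if i = 0 then n - 1 else i - 1)" if "k < n" for k
      using n i that by (auto simp: E_def f_eq next_index)
    then have "{k \<in> {..<n}. f i \<in> E n k} = {i, if i = 0 then n - 1 else i - 1}"
      using i by auto
    moreover have "{e \<in> E n ` {..<n}. f i \<in> e} = E n ` {k \<in> {..<n}. f i \<in> E n k}"
      by blast
    ultimately show ?thesis by simp
  qed
qed

lemma cycle_degree:
  fixes G :: "'a graph"
  assumes "is_cycle G" "x \<in> verts G"
  shows "degree G x = 2"
proof -
  obtain n :: nat and f :: "nat \<Rightarrow> 'a"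
    where n: "n \<ge> 3" and bij: "bij_betw f {..<n} (verts G)"
    and E: "edges G = (\<lambda>i. {f i, f ((i + 1) mod n)}) ` {..<n}" and x: "f 0 = x"
    using cycle_starting_at[OF assms] by blast
  have inj: "inj_on f {..<n}" using bij by (simp add: bij_betw_def)
  let ?E = "\<lambda>i. {f i, f ((i + 1) mod n)}"
  have "{e \<in> edges G. x \<in> e} = {?E 0, ?E (n - 1)}"
    using cycle_incident_edges(2)[OF n inj, of 0] n unfolding E x by simp
  moreover have "?E 0 \<noteq> ?E (n - 1)"
    using inj_onD[OF cycle_incident_edges(1)[OF n inj], of 0 "n - 1"] n by auto
  ultimately show ?thesis unfolding degree_def by simp
qed

text \<open>
  Number the vertices from \<open>v\<close> and give the edge from vertex \<open>i\<close> to vertex \<open>i + 1\<close> the \<open>i\<close>-th term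
  of 1, 1, 2, 2, 1, 1, \<open>\<dots>\<close>, in which any two terms at distance two differ. The colours of the ends of
  edge \<open>i\<close> share the summand of that edge and otherwise consist of the weights of the edges before and
  after it. These are the terms \<open>i - 1\<close> and \<open>i + 1\<close> unless the numbering wraps around, which happens
  only for the edges at vertex 0.
\<close>

lemma cycle_proper_off:
  fixes G :: "'a graph"
  assumes "is_cycle G" "v \<in> verts G"
  shows "\<exists>w. proper_off G v w"
proof -
  obtain n :: nat and f :: "nat \<Rightarrow> 'a"
    where n: "n \<ge> 3" and bij: "bij_betw f {..<n} (verts G)"
    and E: "edges G = (\<lambda>i. {f i, f ((i + 1) mod n)}) ` {..<n}" and v: "f 0 = v"
    using cycle_starting_at[OF assms] by blast
  have inj: "inj_on f {..<n}" using bij by (simp add: bij_betw_def)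
  let ?E = "\<lambda>i. {f i, f ((i + 1) mod n)}"
  note inj_E = cycle_incident_edges(1)[OF n inj]
  define g :: "nat \<Rightarrow> nat" where "g i = 1 + (i div 2) mod 2" for i
  define w where "w e = g (the_inv_into {..<n} ?E e)" for e
  have w: "w (?E i) = g i" if "i < n" for i
    unfolding w_def using the_inv_into_f_f[OF inj_E] that by simp
  have g_alternates: "g i \<noteq> g (Suc (Suc i))" for i
    unfolding g_def by (simp add: mod_Suc)
  \<comment> \<open>Vertex \<open>i + 1\<close> lies between the edges \<open>i\<close> and \<open>i + 1\<close>.\<close>
  have color: "induced_coloring G w (f (Suc i)) = g (Suc i) + g i" if i: "Suc i < n" for i
  proof -
    have "{e \<in> edges G. f (Suc i) \<in> e} = {?E (Suc i), ?E i}"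
      using cycle_incident_edges(2)[OF n inj i] unfolding E by simp
    moreover have "?E (Suc i) \<noteq> ?E i"
      using inj_onD[OF inj_E, of "Suc i" i] i by auto
    ultimately have "induced_coloring G w (f (Suc i)) = w (?E (Suc i)) + w (?E i)"
      unfolding induced_coloring_def by simp
    then show ?thesis using w[of i] w[of "Suc i"] i by simp
  qed
  have off: "induced_coloring G w (f i) \<noteq> induced_coloring G w (f ((i + 1) mod n))"
    if "i < n" "f i \<noteq> v" "f ((i + 1) mod n) \<noteq> v" for i
  proof -
    from that v obtain k where k: "i = Suc k" by (cases i) auto
    have "i + 1 \<noteq> n" using that(3) v by auto
    then have "Suc (Suc k) < n" using that(1) k by simp
    then show ?thesis using color[of k] color[of "Suc k"] g_alternates[of k] k by simp
  qed
  have "induced_coloring G w x \<noteq> induced_coloring G w y"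
    if e: "{x, y} \<in> edges G" and ne: "x \<noteq> v" "y \<noteq> v" for x y
  proof -
    obtain i where "i < n" "{x, y} = ?E i" using e unfolding E by auto
    then show ?thesis using off[of i] ne by (auto simp: doubleton_eq_iff)
  qed
  moreover have "edge_weighting G 2 w"
    unfolding edge_weighting_def E using w by (auto simp: g_def)
  ultimately show ?thesis unfolding proper_off_def by blast
qed

text \<open>
  Each part has degree 2 at the common vertex \<open>v\<close>, and every other vertex keeps the degree 2 that
  it has in its own cycle.
\<close>

lemma degrees_union_of_cycles:
  assumes fsg: "finite_simple_graph G\<^sub>1" "finite_simple_graph G\<^sub>2"
    and common: "verts G\<^sub>1 \<inter> verts G\<^sub>2 = {v}"
    and cyc: "is_cycle G\<^sub>1" "is_cycle G\<^sub>2"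
  shows "degree (graph_union G\<^sub>1 G\<^sub>2) v = 4"
    and "u \<in> neighbours (graph_union G\<^sub>1 G\<^sub>2) v \<Longrightarrow> degree (graph_union G\<^sub>1 G\<^sub>2) u = 2"
proof -
  have "v \<in> verts G\<^sub>1" "v \<in> verts G\<^sub>2" using common by auto
  then show "degree (graph_union G\<^sub>1 G\<^sub>2) v = 4"
    using degree_union_common_vertex[OF fsg common] cycle_degree[OF cyc(1), of v]
      cycle_degree[OF cyc(2), of v] by simp
  assume "u \<in> neighbours (graph_union G\<^sub>1 G\<^sub>2) v"
  then have e: "{u, v} \<in> edges G\<^sub>1 \<union> edges G\<^sub>2" by (simp add: neighbours_def graph_union_def)
  then have "u \<noteq> v" "u \<in> verts G\<^sub>1 \<or> u \<in> verts G\<^sub>2"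
    using edge_ends[OF fsg(1), of u v] edge_ends[OF fsg(2), of u v] by auto
  from \<open>u \<in> verts G\<^sub>1 \<or> u \<in> verts G\<^sub>2\<close>
  show "degree (graph_union G\<^sub>1 G\<^sub>2) u = 2"
  proof
    assume u: "u \<in> verts G\<^sub>1"
    then show ?thesis
      using incident_edges_union[OF fsg(2) common u \<open>u \<noteq> v\<close>] cycle_degree[OF cyc(1) u]
      unfolding degree_def by simp
  next
    assume u: "u \<in> verts G\<^sub>2"
    have "verts G\<^sub>2 \<inter> verts G\<^sub>1 = {v}" using common by (simp add: Int_commute)
    from incident_edges_union[OF fsg(1) this u \<open>u \<noteq> v\<close>] show ?thesis
      using cycle_degree[OF cyc(2) u]
      unfolding degree_def by (subst graph_union_commute) simp
  qed
qed

section \<open>Weighting the union\<close>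

theorem theorem3p1:
  fixes G\<^sub>1 G\<^sub>2 G :: "'a graph" and v :: 'a
  assumes "finite_simple_graph G\<^sub>1" and "connected_graph G\<^sub>1" and "card (verts G\<^sub>1) \<ge> 3"
    and "finite_simple_graph G\<^sub>2" and "connected_graph G\<^sub>2" and "card (verts G\<^sub>2) \<ge> 3"
    and "verts G\<^sub>1 \<inter> verts G\<^sub>2 = {v}"
    and "G = graph_union G\<^sub>1 G\<^sub>2"
    and "(degree G v \<ge> 4 \<and> mu G\<^sub>1 \<le> 2 \<and> mu G\<^sub>2 \<le> 2 \<and> (\<forall>u\<in>neighbours G v. degree G u \<le> 2))
       \<or> (degree G v \<ge> 4 \<and> mu G\<^sub>1 \<le> 2 \<and> (\<forall>u\<in>neighbours G v. degree G u \<le> 2) \<and> is_cycle G\<^sub>2)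
       \<or> (is_cycle G\<^sub>1 \<and> is_cycle G\<^sub>2)"
  shows "mu G \<le> 2"
proof -
  note fsg = assms(1,4) and common = assms(7) and G = assms(8) and cases = assms(9)
  have v: "v \<in> verts G\<^sub>1" "v \<in> verts G\<^sub>2" using common by auto
  obtain w\<^sub>1 w\<^sub>2 where "proper_off G\<^sub>1 v w\<^sub>1" "proper_off G\<^sub>2 v w\<^sub>2"
    using cases mu_le_2_proper_off cycle_proper_off v by metis
  then obtain w where "proper_off G v w"
    using proper_off_union[OF fsg common] unfolding G by blast
  moreover have "degree G v \<ge> 4" "\<forall>u\<in>neighbours G v. degree G u \<le> 2"
    using cases degrees_union_of_cycles[OF fsg common] unfolding G by auto
  moreover have "finite (edges G)"
    using fsg[THEN finite_edges] unfolding G graph_union_def by simp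
  ultimately have "vertex_coloring_edge_weighting G 2 w"
    by (intro vertex_coloring_if_proper_off_high_degree_vertex)
  then show "mu G \<le> 2" using mu_le_iff[of G 2] unfolding numeral_eq_enat by blast
qed

end
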